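(* Consider the two-dimensional Euler equations with gravitation and the semi-discrete discontinuous Galerkin (DG) scheme described in the context, built from a known stationary hydrostatic solution $\{\rho^e({\bf x}),p^e({\bf x}),{\bf u}^e={\bf 0}\}$ with $\nabla p^e=-\rho^e\nabla\phi$. The scheme is well-balanced for this stationary hydrostatic solution; that is, if ${\bf U}_h=\big(\rho_h^e,\,{\bf 0},\,\frac{p_h^e}{\gamma-1}\big)^\top$, then for every cell $K\in\mathcal T_h$ and every $v\in\mathbb V_h^k$ the right-hand side of the scheme vanishes: $$|K|\sum_{q=1}^Q\varpi_q{\bf F}\big({\bf U}_h({\bf x}_K^{(q)})\big)\cdot\nabla v({\bf x}_K^{(q)})+\Big(0,\langle{\bf S}^{[2]},v\rangle_K,\langle S^{[3]},v\rangle_K\Big)^\top-\sum_{\mathscr E\in\partial K}|\mathscr E|\sum_{\mu=1}^N\omega_\mu\widehat{\bf F}_{{\bf n}_{\mathscr E,K}}({\bf x}_{\mathscr E}^{(\mu)})\,v^{{\tt int}(K)}({\bf x}_{\mathscr E}^{(\mu)})={\bf 0}.$$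
   Context: **Euler equations ($d=2$).** Fix $\gamma>1$. States ${\bf U}=(\rho,{\bf m},E)^\top\in\mathbb R^4$, ${\bf m}\in\mathbb R^2$, ${\bf u}={\bf m}/\rho$, $p=(\gamma-1)\big(E-\frac{\|{\bf m}\|^2}{2\rho}\big)$. The system is ${\bf U}_t+\nabla\cdot{\bf F}({\bf U})={\bf S}$, with ${\bf F}({\bf U})=\big(\rho{\bf u},\ \rho{\bf u}\otimes{\bf u}+p{\bf I}_2,\ (E+p){\bf u}\big)^\top$ and ${\bf S}=(0,-\rho\nabla\phi,-{\bf m}\cdot\nabla\phi)^\top$, $\phi({\bf x})$ a static gravitational potential. For ${\bf n}\in\mathbb R^2$, ${\bf F}({\bf U})\cdot{\bf n}=(\rho\,{\bf u}\cdot{\bf n},\ \rho({\bf u}\cdot{\bf n}){\bf u}+p{\bf n},\ (E+p){\bf u}\cdot{\bf n})^\top$. **2D HLLC flux.** For states ${\bf U}_L,{\bf U}_R$ with positive density and pressure and a unit vector ${\bf n}$, let $q_i={\bf u}_i\cdot{\bf n}$, $c_i=\sqrt{\gamma p_i/\rho_i}$ for $i\in\{L,R\}$, $S_L=\min\{q_L-c_L,q_R-c_R\}$, $S_R=\max\{q_L+c_L,q_R+c_R\}$, $$S_*=\frac{p_R-p_L+\rho_Lq_L(S_L-q_L)-\rho_Rq_R(S_R-q_R)}{\rho_L(S_L-q_L)-\rho_R(S_R-q_R)},$$ $${\bf U}_{*i}=\rho_i\frac{S_i-q_i}{S_i-S_*}\Big(1,\ {\bf u}_i+(S_*-q_i){\bf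 n},\ \frac{E_i}{\rho_i}+(S_*-q_i)\Big(S_*+\frac{p_i}{\rho_i(S_i-q_i)}\Big)\Big)^\top,\quad {\bf F}_{*i}={\bf F}({\bf U}_i)\cdot{\bf n}+S_i({\bf U}_{*i}-{\bf U}_i).$$ ${\bf F}^{hllc}({\bf U}_L,{\bf U}_R;{\bf n})$ equals ${\bf F}({\bf U}_L)\cdot{\bf n}$ if $0\le S_L$; ${\bf F}_{*L}$ if $S_L\le0\le S_*$; ${\bf F}_{*R}$ if $S_*\le0\le S_R$; ${\bf F}({\bf U}_R)\cdot{\bf n}$ if $0\ge S_R$. **Mesh and spaces.** $\mathcal T_h$ is a partition of the domain into polygonal cells $K$ (possibly unstructured); $|K|$ is the area, $\mathscr E\in\partial K$ runs over the edges of $K$, $|\mathscr E|$ is the length, ${\bf n}_{\mathscr E,K}$ the outward unit normal. $\mathbb V_h^k$ is the space of $L^2$ functions that are polynomials of total degree at most $k$ on each $K$. Superscripts ${\tt int}(K)$, ${\tt ext}(K)$ denote limits at edges from the interior/exterior of $K$; each edge of $K$ is shared with a neighbouring cell, or at the domain boundary exterior values are those supplied by boundary conditions and satisfy the same hypotheses. $\overline{(\cdot)}_K$ denotes the cell average over $K$. ${\bf U}_h=(\rho_h,{\bf m}_h,E_h)^\top\in[\mathbb V_h^k]^4$. $\rho_h^e,p_h^e\in\mathbb V_h^k$ are the projections of $\rho^e,p^e$, assumed positive at all points where they are evaluated, with $\overline{(\rho_h^e)}_K>0$. $\{{\bf x}_{\mathscr E}^{(\mu)},\omega_\mu\}_{\mu=1}^N$,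 $N=k+1$, are Gauss nodes and normalized weights ($\sum\omega_\mu=1$) on $\mathscr E$; $\{{\bf x}_K^{(q)},\varpi_q\}_{q=1}^Q$ are nodes and normalized weights of a 2D quadrature on $K$. **Scheme.** $p_h^{e,\star}=\frac12\big(p_h^{e,{\tt int}(K)}+p_h^{e,{\tt ext}(K)}\big)$ on edges, $$\widehat{\bf F}_{{\bf n}_{\mathscr E,K}}={\bf F}^{hllc}\Big(\frac{p_h^{e,\star}}{p_h^{e,{\tt int}(K)}}{\bf U}_h^{{\tt int}(K)},\ \frac{p_h^{e,\star}}{p_h^{e,{\tt ext}(K)}}{\bf U}_h^{{\tt ext}(K)};\ {\bf n}_{\mathscr E,K}\Big).$$ With ${\bf b}_K(v)=\sum_{\mathscr E\in\partial K}|\mathscr E|\sum_{\mu=1}^N\omega_\mu p_h^{e,\star}({\bf x}_{\mathscr E}^{(\mu)})v^{{\tt int}(K)}({\bf x}_{\mathscr E}^{(\mu)}){\bf n}_{\mathscr E,K}-|K|\sum_{q=1}^Q\varpi_qp_h^e({\bf x}_K^{(q)})\nabla v({\bf x}_K^{(q)})$, put $$\langle{\bf S}^{[2]},v\rangle_K=|K|\sum_{q=1}^Q\varpi_q\Big(\frac{\rho_h({\bf x}_K^{(q)})}{\rho_h^e({\bf x}_K^{(q)})}-\frac{\overline{(\rho_h)}_K}{\overline{(\rho_h^e)}_K}\Big)\nabla p_h^e({\bf x}_K^{(q)})v({\bf x}_K^{(q)})+\frac{\overline{(\rho_h)}_K}{\overline{(\rho_h^e)}_K}{\bf b}_K(v),$$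 $$\langle S^{[3]},v\rangle_K=|K|\sum_{q=1}^Q\varpi_q\Big(\frac{{\bf m}_h({\bf x}_K^{(q)})}{\rho_h^e({\bf x}_K^{(q)})}-\frac{\overline{({\bf m}_h)}_K}{\overline{(\rho_h^e)}_K}\Big)\cdot\nabla p_h^e({\bf x}_K^{(q)})v({\bf x}_K^{(q)})+\frac{\overline{({\bf m}_h)}_K}{\overline{(\rho_h^e)}_K}\cdot{\bf b}_K(v).$$ The semi-discrete DG scheme is: for all $K\in\mathcal T_h$, $v\in\mathbb V_h^k$, $$\int_K({\bf U}_h)_tv\,d{\bf x}=|K|\sum_{q=1}^Q\varpi_q{\bf F}\big({\bf U}_h({\bf x}_K^{(q)})\big)\cdot\nabla v({\bf x}_K^{(q)})+\Big(0,\langle{\bf S}^{[2]},v\rangle_K,\langle S^{[3]},v\rangle_K\Big)^\top-\sum_{\mathscr E\in\partial K}|\mathscr E|\sum_{\mu=1}^N\omega_\mu\widehat{\bf F}_{{\bf n}_{\mathscr E,K}}({\bf x}_{\mathscr E}^{(\mu)})v^{{\tt int}(K)}({\bf x}_{\mathscr E}^{(\mu)}).$$ *)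

theory Defs
  imports "HOL-Analysis.Analysis"
begin

type_synonym pt = "real ^ 2"

type_synonym state = "real \<times> (real ^ 2) \<times> real"


section \<open>Euler equations\<close>

abbreviation dens :: "state \<Rightarrow> real" where "dens U \<equiv> fst U"
abbreviation mom :: "state \<Rightarrow> real ^ 2" where "mom U \<equiv> fst (snd U)"
abbreviation energy :: "state \<Rightarrow> real" where "energy U \<equiv> snd (snd U)"

definition vel :: "state \<Rightarrow> real ^ 2" where
  "vel U = (1 / dens U) *\<^sub>R mom U"

definition pres :: "real \<Rightarrow> state \<Rightarrow> real" where
  "pres \<gamma> U = (\<gamma> - 1) * (energy U - (norm (mom U))\<^sup>2 / (2 * dens U))"

text \<open>The contraction \<open>F(U) \<cdot> n\<close>; \<open>n\<close> need not be a unit vector.\<close>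

definition flux :: "real \<Rightarrow> state \<Rightarrow> real ^ 2 \<Rightarrow> state" where
  "flux \<gamma> U n =
     (dens U * (vel U \<bullet> n),
      (dens U * (vel U \<bullet> n)) *\<^sub>R vel U + pres \<gamma> U *\<^sub>R n,
      (energy U + pres \<gamma> U) * (vel U \<bullet> n))"

definition GRAD :: "(pt \<Rightarrow> real) \<Rightarrow> pt \<Rightarrow> real ^ 2" where
  "GRAD f x = (THE g. GDERIV f x :> g)"

definition hydrostatic :: "pt set \<Rightarrow> (pt \<Rightarrow> real) \<Rightarrow> (pt \<Rightarrow> real) \<Rightarrow> (pt \<Rightarrow> real) \<Rightarrow> bool" where
  "hydrostatic \<Omega> \<phi> \<rho> p \<longleftrightarrow>
     (\<forall>x\<in>\<Omega>. p differentiable (at x) \<and> \<phi> differentiable (at x) \<and>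
        GRAD p x = - (\<rho> x *\<^sub>R GRAD \<phi> x))"

definition equilibrium_state :: "real \<Rightarrow> real \<Rightarrow> real \<Rightarrow> state" where
  "equilibrium_state \<gamma> \<rho> p = (\<rho>, 0, p / (\<gamma> - 1))"


section \<open>HLLC flux\<close>

definition nvel :: "state \<Rightarrow> real ^ 2 \<Rightarrow> real" where
  "nvel U n = vel U \<bullet> n"

definition sound :: "real \<Rightarrow> state \<Rightarrow> real" where
  "sound \<gamma> U = sqrt (\<gamma> * pres \<gamma> U / dens U)"

definition hllc_SL :: "real \<Rightarrow> state \<Rightarrow> state \<Rightarrow> real ^ 2 \<Rightarrow> real" where
  "hllc_SL \<gamma> UL UR n = min (nvel UL n - sound \<gamma> UL) (nvel UR n - sound \<gamma> UR)"

definition hllc_SR :: "real \<Rightarrow> state \<Rightarrow> state \<Rightarrow> real ^ 2 \<Rightarrow> real" where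
  "hllc_SR \<gamma> UL UR n = max (nvel UL n + sound \<gamma> UL) (nvel UR n + sound \<gamma> UR)"

definition hllc_Sstar :: "real \<Rightarrow> state \<Rightarrow> state \<Rightarrow> real ^ 2 \<Rightarrow> real" where
  "hllc_Sstar \<gamma> UL UR n =
     (let SL = hllc_SL \<gamma> UL UR n; SR = hllc_SR \<gamma> UL UR n;
          qL = nvel UL n; qR = nvel UR n
      in (pres \<gamma> UR - pres \<gamma> UL + dens UL * qL * (SL - qL) - dens UR * qR * (SR - qR))
         / (dens UL * (SL - qL) - dens UR * (SR - qR)))"

definition hllc_Ustar :: "real \<Rightarrow> state \<Rightarrow> real ^ 2 \<Rightarrow> real \<Rightarrow> real \<Rightarrow> state" where
  "hllc_Ustar \<gamma> U n S Sstar =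
     (let q = nvel U n
      in (dens U * ((S - q) / (S - Sstar))) *\<^sub>R
         (1,
          vel U + (Sstar - q) *\<^sub>R n,
          energy U / dens U + (Sstar - q) * (Sstar + pres \<gamma> U / (dens U * (S - q)))))"

definition hllc_Fstar :: "real \<Rightarrow> state \<Rightarrow> real ^ 2 \<Rightarrow> real \<Rightarrow> real \<Rightarrow> state" where
  "hllc_Fstar \<gamma> U n S Sstar = flux \<gamma> U n + S *\<^sub>R (hllc_Ustar \<gamma> U n S Sstar - U)"

definition hllc :: "real \<Rightarrow> state \<Rightarrow> state \<Rightarrow> real ^ 2 \<Rightarrow> state" where
  "hllc \<gamma> UL UR n =
     (let SL = hllc_SL \<gamma> UL UR n; SR = hllc_SR \<gamma> UL UR n; Sst = hllc_Sstar \<gamma> UL UR n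
      in if 0 \<le> SL then flux \<gamma> UL n
         else if SL \<le> 0 \<and> 0 \<le> Sst then hllc_Fstar \<gamma> UL n SL Sst
         else if Sst \<le> 0 \<and> 0 \<le> SR then hllc_Fstar \<gamma> UR n SR Sst
         else flux \<gamma> UR n)"


section \<open>Polygonal meshes and quadratures\<close>

text \<open>
  A polygonal cell is a compact set that is the closure of its interior and whose frontier is
  a simple closed polygon.  Two consecutive edges may be collinear, so that hanging nodes of
  the mesh are vertices of the cell; this is why the set of edges is given in addition to the
  point set of the cell.
\<close>

definition polygon_edge :: "pt list \<Rightarrow> nat \<Rightarrow> pt set" where
  "polygon_edge vs i = closed_segment (vs ! i) (vs ! (Suc i mod length vs))"

definition simple_polygon :: "pt list \<Rightarrow> bool" where
  "simple_polygon vs \<longleftrightarrow> 3 \<le> length vs \<and> distinct vs \<and>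
     (\<forall>i<length vs. \<forall>j<length vs. i \<noteq> j \<longrightarrow>
        polygon_edge vs i \<inter> polygon_edge vs j =
        {vs ! i, vs ! (Suc i mod length vs)} \<inter> {vs ! j, vs ! (Suc j mod length vs)})"

definition polygonal_cell :: "pt set \<Rightarrow> pt set set \<Rightarrow> bool" where
  "polygonal_cell K Es \<longleftrightarrow> compact K \<and> closure (interior K) = K \<and>
     (\<exists>vs. simple_polygon vs \<and> Es = polygon_edge vs ` {..<length vs} \<and> frontier K = \<Union>Es)"

definition outward_normal :: "pt set \<Rightarrow> pt set \<Rightarrow> real ^ 2" where
  "outward_normal K e = (THE n. norm n = 1 \<and> (\<forall>x\<in>e. \<forall>y\<in>e. n \<bullet> (x - y) = 0) \<and>
     (\<forall>x\<in>rel_interior e. \<exists>\<delta>>0. \<forall>t. 0 < t \<and> t < \<delta> \<longrightarrow> x + t *\<^sub>R n \<notin> K))"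

text \<open>
  The number, the nodes and the weights of the cell quadrature may depend on the cell; the edge
  weights do not depend on the edge.  All quadrature indices start from 1.
\<close>

record dg_disc =
  Omega :: "pt set"
  cells :: "pt set set"
  cell_edges :: "pt set \<Rightarrow> pt set set"
  deg :: nat
  enode :: "pt set \<Rightarrow> nat \<Rightarrow> pt"
  ewt :: "nat \<Rightarrow> real"
  cnum :: "pt set \<Rightarrow> nat"
  cnode :: "pt set \<Rightarrow> nat \<Rightarrow> pt"
  cwt :: "pt set \<Rightarrow> nat \<Rightarrow> real"

definition mesh :: "dg_disc \<Rightarrow> bool" where
  "mesh D \<longleftrightarrow> open (Omega D) \<and> connected (Omega D) \<and> finite (cells D) \<and>
     (\<forall>K\<in>cells D. polygonal_cell K (cell_edges D K)) \<and>
     (\<forall>K\<in>cells D. \<forall>K'\<in>cells D. K \<noteq> K' \<longrightarrow> interior K \<inter> interior K' = {}) \<and>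
     (\<Union>K\<in>cells D. interior K) \<subseteq> Omega D \<and> Omega D \<subseteq> \<Union>(cells D) \<and>
     (\<forall>K\<in>cells D. \<forall>e\<in>cell_edges D K. e \<subseteq> frontier (Omega D) \<or>
        (\<exists>!K'. K' \<in> cells D \<and> K' \<noteq> K \<and> e \<in> cell_edges D K'))"

definition neighbour :: "dg_disc \<Rightarrow> pt set \<Rightarrow> pt set \<Rightarrow> pt set" where
  "neighbour D K e = (THE K'. K' \<in> cells D \<and> K' \<noteq> K \<and> e \<in> cell_edges D K')"

abbreviation nedge :: "dg_disc \<Rightarrow> nat" where
  "nedge D \<equiv> deg D + 1"

text \<open>
  Gauss nodes and weights on \<open>[0, 1]\<close>: the \<open>N\<close>-point rule that integrates exactly all
  polynomials of degree at most \<open>2 N - 1\<close>.  Since the length of the interval is 1, the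
  weights sum to 1.
\<close>

definition gauss_rule :: "nat \<Rightarrow> (nat \<Rightarrow> real) \<Rightarrow> (nat \<Rightarrow> real) \<Rightarrow> bool" where
  "gauss_rule N \<xi> \<omega> \<longleftrightarrow> inj_on \<xi> {1..N} \<and> \<xi> ` {1..N} \<subseteq> {0..1} \<and>
     (\<forall>c. (\<Sum>\<mu>=1..N. \<omega> \<mu> * (\<Sum>i<2*N. c i * \<xi> \<mu> ^ i)) =
          integral {0..1} (\<lambda>t::real. \<Sum>i<2*N. c i * t ^ i))"

definition quadratures :: "dg_disc \<Rightarrow> bool" where
  "quadratures D \<longleftrightarrow>
     (\<exists>\<xi>. gauss_rule (nedge D) \<xi> (ewt D) \<and>
        (\<forall>K\<in>cells D. \<forall>e\<in>cell_edges D K. \<exists>a b. e = closed_segment a b \<and>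
           (\<forall>\<mu>\<in>{1..nedge D}. enode D e \<mu> = a + \<xi> \<mu> *\<^sub>R (b - a)))) \<and>
     (\<forall>K\<in>cells D. (\<forall>q\<in>{1..cnum D K}. cnode D K q \<in> K) \<and> (\<Sum>q=1..cnum D K. cwt D K q) = 1)"


section \<open>Discontinuous piecewise polynomials\<close>

definition bipoly :: "nat \<Rightarrow> (pt \<Rightarrow> real) \<Rightarrow> bool" where
  "bipoly k P \<longleftrightarrow>
     (\<exists>c. \<forall>x. P x = (\<Sum>(i, j) \<in> {(i, j). i + j \<le> k}. c i j * (x $ 1) ^ i * (x $ 2) ^ j))"

text \<open>
  Elements of the discrete space are functions on the domain whose values on the mesh skeleton
  are irrelevant; two of them are the same element iff they agree on the open cells.
\<close>

definition Vh :: "dg_disc \<Rightarrow> (pt \<Rightarrow> real) set" where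
  "Vh D = {v. v \<in> borel_measurable (lebesgue_on (Omega D)) \<and>
              integrable (lebesgue_on (Omega D)) (\<lambda>x. (v x)\<^sup>2) \<and>
              (\<forall>K\<in>cells D. \<exists>P. bipoly (deg D) P \<and> (\<forall>x\<in>interior K. v x = P x))}"

definition Vh_state :: "dg_disc \<Rightarrow> (pt \<Rightarrow> state) set" where
  "Vh_state D = {U. (\<lambda>x. dens (U x)) \<in> Vh D \<and> (\<forall>i. (\<lambda>x. mom (U x) $ i) \<in> Vh D) \<and>
                    (\<lambda>x. energy (U x)) \<in> Vh D}"

definition cellwise_eq :: "dg_disc \<Rightarrow> (pt \<Rightarrow> 'a) \<Rightarrow> (pt \<Rightarrow> 'a) \<Rightarrow> bool" where
  "cellwise_eq D f g \<longleftrightarrow> (\<forall>K\<in>cells D. \<forall>x\<in>interior K. f x = g x)"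

text \<open>
  A linear projection onto the discrete space, defined on a linear space \<open>X\<close> of functions.  This
  covers the \<open>L\<^sup>2\<close> projection (\<open>X = L\<^sup>2\<close>) as well as interpolation (\<open>X\<close> the continuous functions).
\<close>

definition projection ::
  "dg_disc \<Rightarrow> (pt \<Rightarrow> real) set \<Rightarrow> ((pt \<Rightarrow> real) \<Rightarrow> (pt \<Rightarrow> real)) \<Rightarrow> bool" where
  "projection D X proj \<longleftrightarrow>
     (\<forall>f\<in>X. \<forall>g\<in>X. \<forall>a b. (\<lambda>x. a * f x + b * g x) \<in> X \<and>
        cellwise_eq D (proj (\<lambda>x. a * f x + b * g x)) (\<lambda>x. a * proj f x + b * proj g x)) \<and>
     (\<forall>f\<in>X. proj f \<in> Vh D) \<and>
     (\<forall>f\<in>X \<inter> Vh D. cellwise_eq D (proj f) f)"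

text \<open>
  The value at \<open>x \<in> K\<close> of the restriction of \<open>f\<close> to \<open>K\<close>, i.e. the limit from the interior of
  \<open>K\<close>.  It is used both for the interior traces at edges and at the nodes of the cell quadrature,
  which may lie on the boundary of the cell; likewise for gradients.
\<close>

definition int_val :: "pt set \<Rightarrow> (pt \<Rightarrow> 'a::t2_space) \<Rightarrow> pt \<Rightarrow> 'a" where
  "int_val K f x = Lim (at x within interior K) f"

definition cell_grad :: "pt set \<Rightarrow> (pt \<Rightarrow> real) \<Rightarrow> pt \<Rightarrow> real ^ 2" where
  "cell_grad K f x = int_val K (GRAD f) x"

text \<open>
  \<open>b K e x\<close> is the exterior value supplied by the boundary conditions at a point \<open>x\<close> of a
  boundary edge \<open>e\<close> of \<open>K\<close>.
\<close>

definition ext_val ::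
  "dg_disc \<Rightarrow> (pt set \<Rightarrow> pt set \<Rightarrow> pt \<Rightarrow> 'a::t2_space) \<Rightarrow> (pt \<Rightarrow> 'a) \<Rightarrow> pt set \<Rightarrow> pt set \<Rightarrow> pt \<Rightarrow> 'a"
where
  "ext_val D b f K e x =
     (if e \<subseteq> frontier (Omega D) then b K e x else int_val (neighbour D K e) f x)"

definition area :: "pt set \<Rightarrow> real" where
  "area K = measure lebesgue K"

definition cell_avg :: "pt set \<Rightarrow> (pt \<Rightarrow> 'a::euclidean_space) \<Rightarrow> 'a" where
  "cell_avg K f = (1 / area K) *\<^sub>R integral K f"

definition positive_where_evaluated ::
  "dg_disc \<Rightarrow> (pt set \<Rightarrow> pt set \<Rightarrow> pt \<Rightarrow> real) \<Rightarrow> (pt \<Rightarrow> real) \<Rightarrow> bool" where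
  "positive_where_evaluated D b f \<longleftrightarrow>
     (\<forall>K\<in>cells D. (\<forall>q\<in>{1..cnum D K}. 0 < int_val K f (cnode D K q)) \<and>
        (\<forall>e\<in>cell_edges D K. \<forall>\<mu>\<in>{1..nedge D}.
           0 < int_val K f (enode D e \<mu>) \<and> 0 < ext_val D b f K e (enode D e \<mu>)))"


section \<open>The scheme\<close>

definition p_star ::
  "dg_disc \<Rightarrow> (pt set \<Rightarrow> pt set \<Rightarrow> pt \<Rightarrow> real) \<Rightarrow> (pt \<Rightarrow> real) \<Rightarrow> pt set \<Rightarrow> pt set \<Rightarrow> pt \<Rightarrow> real"
where
  "p_star D bp ph K e x = (int_val K ph x + ext_val D bp ph K e x) / 2"

definition num_flux ::
  "real \<Rightarrow> dg_disc \<Rightarrow> (pt set \<Rightarrow> pt set \<Rightarrow> pt \<Rightarrow> real) \<Rightarrow> (pt \<Rightarrow> real) \<Rightarrow>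
   (pt set \<Rightarrow> pt set \<Rightarrow> pt \<Rightarrow> state) \<Rightarrow> (pt \<Rightarrow> state) \<Rightarrow> pt set \<Rightarrow> pt set \<Rightarrow> pt \<Rightarrow> state"
where
  "num_flux \<gamma> D bp ph bU U K e x =
     hllc \<gamma> ((p_star D bp ph K e x / int_val K ph x) *\<^sub>R int_val K U x)
            ((p_star D bp ph K e x / ext_val D bp ph K e x) *\<^sub>R ext_val D bU U K e x)
            (outward_normal K e)"

definition b_vec ::
  "dg_disc \<Rightarrow> (pt set \<Rightarrow> pt set \<Rightarrow> pt \<Rightarrow> real) \<Rightarrow> (pt \<Rightarrow> real) \<Rightarrow> pt set \<Rightarrow> (pt \<Rightarrow> real) \<Rightarrow> real ^ 2"
where
  "b_vec D bp ph K v =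
     (\<Sum>e\<in>cell_edges D K. diameter e *\<^sub>R
        (\<Sum>\<mu>=1..nedge D. (ewt D \<mu> * p_star D bp ph K e (enode D e \<mu>) * int_val K v (enode D e \<mu>))
           *\<^sub>R outward_normal K e))
     - area K *\<^sub>R (\<Sum>q=1..cnum D K. (cwt D K q * int_val K ph (cnode D K q))
           *\<^sub>R cell_grad K v (cnode D K q))"

definition source2 ::
  "dg_disc \<Rightarrow> (pt \<Rightarrow> real) \<Rightarrow> (pt set \<Rightarrow> pt set \<Rightarrow> pt \<Rightarrow> real) \<Rightarrow> (pt \<Rightarrow> real) \<Rightarrow>
   (pt \<Rightarrow> state) \<Rightarrow> pt set \<Rightarrow> (pt \<Rightarrow> real) \<Rightarrow> real ^ 2"
where
  "source2 D \<rho>h bp ph U K v =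
     area K *\<^sub>R (\<Sum>q=1..cnum D K.
        (cwt D K q *
         (dens (int_val K U (cnode D K q)) / int_val K \<rho>h (cnode D K q)
          - cell_avg K (\<lambda>x. dens (U x)) / cell_avg K \<rho>h) *
         int_val K v (cnode D K q)) *\<^sub>R cell_grad K ph (cnode D K q))
     + (cell_avg K (\<lambda>x. dens (U x)) / cell_avg K \<rho>h) *\<^sub>R b_vec D bp ph K v"

definition source3 ::
  "dg_disc \<Rightarrow> (pt \<Rightarrow> real) \<Rightarrow> (pt set \<Rightarrow> pt set \<Rightarrow> pt \<Rightarrow> real) \<Rightarrow> (pt \<Rightarrow> real) \<Rightarrow>
   (pt \<Rightarrow> state) \<Rightarrow> pt set \<Rightarrow> (pt \<Rightarrow> real) \<Rightarrow> real"
where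
  "source3 D \<rho>h bp ph U K v =
     area K * (\<Sum>q=1..cnum D K.
        cwt D K q *
        (((1 / int_val K \<rho>h (cnode D K q)) *\<^sub>R mom (int_val K U (cnode D K q))
          - (1 / cell_avg K \<rho>h) *\<^sub>R cell_avg K (\<lambda>x. mom (U x)))
         \<bullet> cell_grad K ph (cnode D K q)) * int_val K v (cnode D K q))
     + ((1 / cell_avg K \<rho>h) *\<^sub>R cell_avg K (\<lambda>x. mom (U x))) \<bullet> b_vec D bp ph K v"

definition dg_rhs ::
  "real \<Rightarrow> dg_disc \<Rightarrow> (pt \<Rightarrow> real) \<Rightarrow> (pt set \<Rightarrow> pt set \<Rightarrow> pt \<Rightarrow> real) \<Rightarrow> (pt \<Rightarrow> real) \<Rightarrow>
   (pt set \<Rightarrow> pt set \<Rightarrow> pt \<Rightarrow> state) \<Rightarrow> (pt \<Rightarrow> state) \<Rightarrow> pt set \<Rightarrow> (pt \<Rightarrow> real) \<Rightarrow> state"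
where
  "dg_rhs \<gamma> D \<rho>h bp ph bU U K v =
     area K *\<^sub>R (\<Sum>q=1..cnum D K.
        cwt D K q *\<^sub>R flux \<gamma> (int_val K U (cnode D K q)) (cell_grad K v (cnode D K q)))
     + (0, source2 D \<rho>h bp ph U K v, source3 D \<rho>h bp ph U K v)
     - (\<Sum>e\<in>cell_edges D K. diameter e *\<^sub>R
          (\<Sum>\<mu>=1..nedge D. (ewt D \<mu> * int_val K v (enode D e \<mu>))
             *\<^sub>R num_flux \<gamma> D bp ph bU U K e (enode D e \<mu>)))"

end

theory Submission
  imports Defs
begin

text \<open>
  At rest the only part of the Euler flux that survives is the pressure, so the normal flux of an
  equilibrium state is \<open>(0, p n, 0)\<close> (\<open>flux_equilibrium\<close>).  The factors \<open>p\<^sup>\<star> / p\<close> in front of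
  the two arguments of the Riemann solver turn the equilibrium traces on the two sides of an edge
  into states at rest with the common pressure \<open>p\<^sup>\<star>\<close>, so that at most a stationary contact
  discontinuity is left.  HLLC resolves it exactly, and the numerical flux is \<open>(0, p\<^sup>\<star> n, 0)\<close>
  (\<open>hllc_stationary_contact\<close>, \<open>num_flux_equilibrium\<close>).  Moreover the ratio of the density to
  the equilibrium density is 1 both at the nodes and for the cell averages, which removes the
  corrections from the source terms: the one in the momentum equation is \<open>b(v)\<close>, the one in the
  energy equation 0.  As \<open>b(v)\<close> was built as the edge sum of \<open>p\<^sup>\<star> v n\<close> minus the cell
  quadrature of \<open>p \<nabla>v\<close>, with the very nodes and weights of the scheme, it cancels the two flux
  terms exactly.

  What remains is to see that the equilibrium relation, which holds in the open cells, passes to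
  the limits taken at nodes on the boundary of a cell (\<open>int_val_equilibrium\<close>) and to the averages
  over the closed cell (\<open>cell_avg_cong_interior\<close>).
\<close>


section \<open>Equilibrium states and the HLLC flux\<close>

lemma scaleR_equilibrium_state:
  "c *\<^sub>R equilibrium_state \<gamma> \<rho> p = equilibrium_state \<gamma> (c * \<rho>) (c * p)"
  by (simp add: equilibrium_state_def)

lemma vel_equilibrium [simp]: "vel (equilibrium_state \<gamma> \<rho> p) = 0"
  by (simp add: vel_def equilibrium_state_def)

lemma pres_equilibrium [simp]: "\<gamma> \<noteq> 1 \<Longrightarrow> pres \<gamma> (equilibrium_state \<gamma> \<rho> p) = p"
  by (simp add: pres_def equilibrium_state_def)

lemma flux_equilibrium:
  "\<gamma> \<noteq> 1 \<Longrightarrow> flux \<gamma> (equilibrium_state \<gamma> \<rho> p) n = (0, p *\<^sub>R n, 0)"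
  by (simp add: flux_def)

lemma sound_equilibrium_pos:
  "\<gamma> > 1 \<Longrightarrow> \<rho> > 0 \<Longrightarrow> p > 0 \<Longrightarrow> 0 < sound \<gamma> (equilibrium_state \<gamma> \<rho> p)"
  by (simp add: sound_def) (simp add: equilibrium_state_def)

lemma hllc_Ustar_contact:
  assumes "S \<noteq> 0" "\<rho> \<noteq> 0"
  shows "hllc_Ustar \<gamma> (equilibrium_state \<gamma> \<rho> p) n S 0 = equilibrium_state \<gamma> \<rho> p"
  using assms by (simp add: hllc_Ustar_def nvel_def) (simp add: equilibrium_state_def)

text \<open>
  With equal pressures and no motion the contact speed \<open>S\<^sub>*\<close> is 0 and lies strictly between
  \<open>S\<^sub>L < 0 < S\<^sub>R\<close>, so the flux is the one to the left of the contact; as the intermediate state is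
  the left state itself, the jump term of that flux disappears.
\<close>

lemma hllc_stationary_contact:
  assumes "\<gamma> > 1" "\<rho>L > 0" "\<rho>R > 0" "p > 0"
  shows "hllc \<gamma> (equilibrium_state \<gamma> \<rho>L p) (equilibrium_state \<gamma> \<rho>R p) n = (0, p *\<^sub>R n, 0)"
proof -
  let ?L = "equilibrium_state \<gamma> \<rho>L p" and ?R = "equilibrium_state \<gamma> \<rho>R p"
  have SL: "hllc_SL \<gamma> ?L ?R n < 0"
    using sound_equilibrium_pos[of \<gamma> \<rho>L p] assms by (simp add: hllc_SL_def nvel_def min_less_iff_disj)
  have Sstar: "hllc_Sstar \<gamma> ?L ?R n = 0"
    using assms by (simp add: hllc_Sstar_def nvel_def Let_def)
  show ?thesis
    using SL Sstar assms
    by (simp add: hllc_def Let_def hllc_Fstar_def hllc_Ustar_contact flux_equilibrium)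
qed


section \<open>Limits and averages on a cell\<close>

text \<open>Every point of a cell is a limit point of its interior, so limits from inside are unique.\<close>

lemma int_val_eqI:
  fixes f :: "pt \<Rightarrow> 'a::t2_space"
  assumes "x \<in> closure (interior K)" "(f \<longlongrightarrow> l) (at x within interior K)"
  shows "int_val K f x = l"
proof -
  have "x islimpt interior K"
    using assms(1) interior_limit_point[of x "interior K"] by (auto simp: closure_def)
  then show ?thesis
    unfolding int_val_def using assms(2) by (intro tendsto_Lim) (auto simp: trivial_limit_within)
qed

lemma tendsto_bipoly:
  assumes "bipoly k P"
  shows "(P \<longlongrightarrow> P x) (at x within S)"
proof -
  obtain c where P: "P = (\<lambda>x. \<Sum>(i, j) \<in> {(i, j). i + j \<le> k}. c i j * (x $ 1) ^ i * (x $ 2) ^ j)"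
    using assms unfolding bipoly_def by blast
  show ?thesis
    unfolding P case_prod_beta by (intro tendsto_intros)
qed

text \<open>
  On a cell a discrete function is a polynomial, which is continuous up to the boundary, so the
  limit whose value \<open>int_val\<close> denotes does exist.
\<close>

lemma Vh_tendsto_int_val:
  assumes "f \<in> Vh D" "K \<in> cells D" "x \<in> closure (interior K)"
  shows "(f \<longlongrightarrow> int_val K f x) (at x within interior K)"
proof -
  obtain P where P: "bipoly (deg D) P" "\<And>y. y \<in> interior K \<Longrightarrow> f y = P y"
    using assms unfolding Vh_def by blast
  have "eventually (\<lambda>y. P y = f y) (at x within interior K)"
    using P(2) by (auto simp: eventually_at_filter)
  with tendsto_bipoly[OF P(1)] have lim: "(f \<longlongrightarrow> P x) (at x within interior K)"
    by (rule Lim_transform_eventually)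
  show ?thesis
    using int_val_eqI[OF assms(3) lim] lim by simp
qed

lemma int_val_equilibrium:
  assumes "\<gamma> \<noteq> 1" "\<rho>h \<in> Vh D" "ph \<in> Vh D" "K \<in> cells D" "x \<in> closure (interior K)"
    and U: "cellwise_eq D U (\<lambda>x. equilibrium_state \<gamma> (\<rho>h x) (ph x))"
  shows "int_val K U x = equilibrium_state \<gamma> (int_val K \<rho>h x) (int_val K ph x)"
proof (rule int_val_eqI[OF assms(5)])
  have "eventually (\<lambda>y. equilibrium_state \<gamma> (\<rho>h y) (ph y) = U y) (at x within interior K)"
    using U assms(4) by (auto simp: eventually_at_filter cellwise_eq_def)
  moreover have "((\<lambda>y. equilibrium_state \<gamma> (\<rho>h y) (ph y)) \<longlongrightarrow>
      equilibrium_state \<gamma> (int_val K \<rho>h x) (int_val K ph x)) (at x within interior K)"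
    unfolding equilibrium_state_def using assms(1)
    by (intro tendsto_intros Vh_tendsto_int_val[OF assms(2,4,5)] Vh_tendsto_int_val[OF assms(3,4,5)])
      simp
  ultimately show "(U \<longlongrightarrow> equilibrium_state \<gamma> (int_val K \<rho>h x) (int_val K ph x))
      (at x within interior K)"
    by (rule Lim_transform_eventually[rotated])
qed

lemma negligible_closed_segment:
  fixes a b :: "'a::euclidean_space"
  assumes "2 \<le> DIM('a)"
  shows "negligible (closed_segment a b)"
proof (rule negligible_convex_interior[THEN iffD2])
  have "aff_dim (closed_segment a b) \<le> 1"
    unfolding segment_convex_hull aff_dim_convex_hull using aff_dim_le_card[of "{a, b}"]
    by (simp add: card_insert_if split: if_splits)
  then show "interior (closed_segment a b) = {}"
    using assms by (intro low_dim_interior) auto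
qed simp

lemma negligible_frontier_polygonal_cell:
  assumes "polygonal_cell K Es"
  shows "negligible (frontier K)"
proof -
  obtain vs where "Es = polygon_edge vs ` {..<length vs}" "frontier K = \<Union>Es"
    using assms unfolding polygonal_cell_def by blast
  then show ?thesis
    by (auto simp: polygon_edge_def intro!: negligible_closed_segment)
qed

text \<open>The frontier consists of finitely many segments, so integrals over a cell do not see it.\<close>

lemma cell_avg_cong_interior:
  assumes "polygonal_cell K Es" "\<And>x. x \<in> interior K \<Longrightarrow> f x = g x"
  shows "cell_avg K f = cell_avg K g"
proof -
  have "integral K f = integral K g"
    by (rule integral_spike[OF negligible_frontier_polygonal_cell[OF assms(1)]])
      (use assms closure_subset[of K] in \<open>auto simp: frontier_def\<close>)
  then show ?thesis by (simp add: cell_avg_def)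
qed


section \<open>Mesh and numerical flux\<close>

lemma mesh_cell:
  assumes "mesh D" "K \<in> cells D"
  shows "polygonal_cell K (cell_edges D K)" "closure (interior K) = K"
  using assms by (auto simp: mesh_def polygonal_cell_def)

lemma edge_subset_closure_interior:
  assumes "mesh D" "K \<in> cells D" "e \<in> cell_edges D K"
  shows "e \<subseteq> closure (interior K)"
proof -
  have "e \<subseteq> frontier K" "compact K"
    using mesh_cell(1)[OF assms(1,2)] assms(3) by (auto simp: polygonal_cell_def)
  then show ?thesis
    using mesh_cell(2)[OF assms(1,2)] frontier_subset_closed compact_imp_closed by blast
qed

lemma neighbour_shares_edge:
  assumes "mesh D" "K \<in> cells D" "e \<in> cell_edges D K" "\<not> e \<subseteq> frontier (Omega D)"
  shows "neighbour D K e \<in> cells D" "e \<in> cell_edges D (neighbour D K e)"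
proof -
  have "\<forall>K\<in>cells D. \<forall>e\<in>cell_edges D K. e \<subseteq> frontier (Omega D) \<or>
      (\<exists>!K'. K' \<in> cells D \<and> K' \<noteq> K \<and> e \<in> cell_edges D K')"
    using assms(1) unfolding mesh_def by (elim conjE)
  then have "\<exists>!K'. K' \<in> cells D \<and> K' \<noteq> K \<and> e \<in> cell_edges D K'"
    using assms(2-4) by (auto dest!: bspec)
  from theI'[OF this] show "neighbour D K e \<in> cells D" "e \<in> cell_edges D (neighbour D K e)"
    unfolding neighbour_def by blast+
qed

lemma enode_in_edge:
  assumes "quadratures D" "K \<in> cells D" "e \<in> cell_edges D K" "\<mu> \<in> {1..nedge D}"
  shows "enode D e \<mu> \<in> e"
proof -
  obtain \<xi> where \<xi>: "gauss_rule (nedge D) \<xi> (ewt D)"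
    and nodes: "\<forall>K\<in>cells D. \<forall>e\<in>cell_edges D K. \<exists>a b. e = closed_segment a b \<and>
      (\<forall>\<mu>\<in>{1..nedge D}. enode D e \<mu> = a + \<xi> \<mu> *\<^sub>R (b - a))"
    using assms(1) unfolding quadratures_def by (elim conjE exE)
  obtain a b where e: "e = closed_segment a b"
    and "\<forall>\<mu>\<in>{1..nedge D}. enode D e \<mu> = a + \<xi> \<mu> *\<^sub>R (b - a)"
    using bspec[OF bspec[OF nodes assms(2)] assms(3)] by (elim exE conjE)
  then have node: "enode D e \<mu> = a + \<xi> \<mu> *\<^sub>R (b - a)"
    using assms(4) by (elim bspec)
  have "\<xi> \<mu> \<in> {0..1}"
    using \<xi> assms(4) unfolding gauss_rule_def by (elim conjE) (rule subsetD, assumption, rule imageI)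
  then show ?thesis
    unfolding node unfolding e in_segment by (auto intro!: exI[of _ "\<xi> \<mu>"] simp: algebra_simps)
qed

text \<open>
  Across an interior edge the exterior trace is the interior trace of the neighbour, across a
  boundary edge it is the equilibrium supplied by the boundary conditions.
\<close>

lemma ext_val_equilibrium:
  assumes "\<gamma> \<noteq> 1" "mesh D" "\<rho>h \<in> Vh D" "ph \<in> Vh D" "K \<in> cells D" "e \<in> cell_edges D K" "x \<in> e"
    and "cellwise_eq D U (\<lambda>x. equilibrium_state \<gamma> (\<rho>h x) (ph x))"
    and "e \<subseteq> frontier (Omega D) \<Longrightarrow> bU K e x = equilibrium_state \<gamma> (b\<rho> K e x) (bp K e x)"
  shows "ext_val D bU U K e x =
    equilibrium_state \<gamma> (ext_val D b\<rho> \<rho>h K e x) (ext_val D bp ph K e x)"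
proof (cases "e \<subseteq> frontier (Omega D)")
  case True
  then show ?thesis using assms(9) by (simp add: ext_val_def)
next
  case False
  note nb = neighbour_shares_edge[OF assms(2,5,6) False]
  have "x \<in> closure (interior (neighbour D K e))"
    using edge_subset_closure_interior[OF assms(2) nb] assms(7) by blast
  then show ?thesis
    using False int_val_equilibrium[OF assms(1,3,4) nb(1) _ assms(8)] by (simp add: ext_val_def)
qed

text \<open>
  The scaling by \<open>p\<^sup>\<star> / p\<close> preserves rest and makes the two pressures equal to \<open>p\<^sup>\<star>\<close>; the
  densities may still differ, so what the Riemann solver sees is a stationary contact.
\<close>

lemma num_flux_equilibrium:
  assumes "\<gamma> > 1"
    and U: "int_val K U x = equilibrium_state \<gamma> \<rho>i (int_val K ph x)"
      "ext_val D bU U K e x = equilibrium_state \<gamma> \<rho>o (ext_val D bp ph K e x)"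
    and pos: "0 < \<rho>i" "0 < int_val K ph x" "0 < \<rho>o" "0 < ext_val D bp ph K e x"
  shows "num_flux \<gamma> D bp ph bU U K e x = (0, p_star D bp ph K e x *\<^sub>R outward_normal K e, 0)"
proof -
  have "0 < p_star D bp ph K e x"
    using pos by (simp add: p_star_def)
  then show ?thesis
    unfolding num_flux_def U scaleR_equilibrium_state using pos assms(1)
    by (simp add: hllc_stationary_contact)
qed

lemma sum_momentum_only:
  "(\<Sum>i\<in>A. (0::'a::comm_monoid_add, f i :: 'b::comm_monoid_add, 0::'c::comm_monoid_add)) =
    (0, sum f A, 0)"
  by (induction A rule: infinite_finite_induct) (auto simp: zero_prod_def)


section \<open>Well-balancedness\<close>

theorem theorem4p1:
  fixes \<gamma> :: real and D :: dg_disc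
    and \<phi> \<rho>e pe \<rho>h ph :: "pt \<Rightarrow> real"
    and X :: "(pt \<Rightarrow> real) set" and proj :: "(pt \<Rightarrow> real) \<Rightarrow> (pt \<Rightarrow> real)"
    and b\<rho> bp :: "pt set \<Rightarrow> pt set \<Rightarrow> pt \<Rightarrow> real"
    and U :: "pt \<Rightarrow> state" and bU :: "pt set \<Rightarrow> pt set \<Rightarrow> pt \<Rightarrow> state"
  assumes "\<gamma> > 1"
    and "mesh D" and "quadratures D"
    and "hydrostatic (Omega D) \<phi> \<rho>e pe"
    and "projection D X proj" and "\<rho>e \<in> X" and "pe \<in> X"
    and "\<rho>h = proj \<rho>e" and "ph = proj pe"
    and "positive_where_evaluated D b\<rho> \<rho>h"
    and "positive_where_evaluated D bp ph"
    and "\<forall>K\<in>cells D. cell_avg K \<rho>h > 0"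
    and "U \<in> Vh_state D"
    and "cellwise_eq D U (\<lambda>x. equilibrium_state \<gamma> (\<rho>h x) (ph x))"
    and "\<forall>K\<in>cells D. \<forall>e\<in>cell_edges D K. e \<subseteq> frontier (Omega D) \<longrightarrow>
           (\<forall>\<mu>\<in>{1..nedge D}. bU K e (enode D e \<mu>) =
              equilibrium_state \<gamma> (b\<rho> K e (enode D e \<mu>)) (bp K e (enode D e \<mu>)))"
  shows "\<forall>K\<in>cells D. \<forall>v\<in>Vh D. dg_rhs \<gamma> D \<rho>h bp ph bU U K v = 0"
proof (intro ballI)
  fix K v assume K: "K \<in> cells D" and "v \<in> Vh D"
  have \<gamma>: "\<gamma> \<noteq> 1" using assms(1) by simp
  have Vh: "\<rho>h \<in> Vh D" "ph \<in> Vh D"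
    using assms(5-9) by (auto simp: projection_def)
  note cell = mesh_cell[OF assms(2) K]
  have U_eq: "U x = equilibrium_state \<gamma> (\<rho>h x) (ph x)" if "x \<in> interior K" for x
    using assms(14) K that by (auto simp: cellwise_eq_def)
  have avg_dens: "cell_avg K (\<lambda>x. dens (U x)) = cell_avg K \<rho>h"
    by (rule cell_avg_cong_interior[OF cell(1)]) (simp add: U_eq equilibrium_state_def)
  have "cell_avg K (\<lambda>x. mom (U x)) = cell_avg K (\<lambda>x. 0)"
    by (rule cell_avg_cong_interior[OF cell(1)]) (simp add: U_eq equilibrium_state_def)
  then have avg_mom: "cell_avg K (\<lambda>x. mom (U x)) = 0"
    by (simp add: cell_avg_def)
  have avg_pos: "cell_avg K \<rho>h \<noteq> 0"
    using assms(12) K by force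
  have node_U: "int_val K U (cnode D K q) =
        equilibrium_state \<gamma> (int_val K \<rho>h (cnode D K q)) (int_val K ph (cnode D K q))"
    and node_pos: "int_val K \<rho>h (cnode D K q) \<noteq> 0" if "q \<in> {1..cnum D K}" for q
  proof -
    have "cnode D K q \<in> closure (interior K)"
      using assms(3) K that cell(2) by (auto simp: quadratures_def)
    then show "int_val K U (cnode D K q) =
        equilibrium_state \<gamma> (int_val K \<rho>h (cnode D K q)) (int_val K ph (cnode D K q))"
      by (rule int_val_equilibrium[OF \<gamma> Vh K _ assms(14)])
    have "0 < int_val K \<rho>h (cnode D K q)"
      using assms(10) K that unfolding positive_where_evaluated_def by blast
    then show "int_val K \<rho>h (cnode D K q) \<noteq> 0" by simp
  qed
  have edge_flux: "num_flux \<gamma> D bp ph bU U K e (enode D e \<mu>) =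
      (0, p_star D bp ph K e (enode D e \<mu>) *\<^sub>R outward_normal K e, 0)"
    if e: "e \<in> cell_edges D K" and \<mu>: "\<mu> \<in> {1..nedge D}" for e \<mu>
  proof -
    note x = enode_in_edge[OF assms(3) K e \<mu>]
    have xK: "enode D e \<mu> \<in> closure (interior K)"
      using edge_subset_closure_interior[OF assms(2) K e] x by blast
    have ext: "ext_val D bU U K e (enode D e \<mu>) = equilibrium_state \<gamma>
        (ext_val D b\<rho> \<rho>h K e (enode D e \<mu>)) (ext_val D bp ph K e (enode D e \<mu>))"
      by (rule ext_val_equilibrium[OF \<gamma> assms(2) Vh K e x assms(14)])
        (use assms(15) K e \<mu> in blast)
    show ?thesis
      by (rule num_flux_equilibrium[OF assms(1) int_val_equilibrium[OF \<gamma> Vh K xK assms(14)] ext])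
        (use assms(10,11) K e \<mu> in \<open>unfold positive_where_evaluated_def, blast+\<close>)
  qed
  have S2: "source2 D \<rho>h bp ph U K v = b_vec D bp ph K v"
  proof -
    \<comment> \<open>node by node, the correction factor is \<open>1 - 1\<close>\<close>
    have "(\<Sum>q=1..cnum D K.
        (cwt D K q *
         (dens (int_val K U (cnode D K q)) / int_val K \<rho>h (cnode D K q)
          - cell_avg K (\<lambda>x. dens (U x)) / cell_avg K \<rho>h) *
         int_val K v (cnode D K q)) *\<^sub>R cell_grad K ph (cnode D K q)) = 0"
      by (rule sum.neutral)
        (use node_U node_pos avg_pos in \<open>auto simp: avg_dens equilibrium_state_def\<close>)
    then show ?thesis
      unfolding source2_def using avg_pos by (simp add: avg_dens)
  qed
  have S3: "source3 D \<rho>h bp ph U K v = 0"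
    unfolding source3_def using node_U by (simp add: avg_mom equilibrium_state_def)
  have vol: "(\<Sum>q=1..cnum D K.
        cwt D K q *\<^sub>R flux \<gamma> (int_val K U (cnode D K q)) (cell_grad K v (cnode D K q))) =
      (0, \<Sum>q=1..cnum D K. (cwt D K q * int_val K ph (cnode D K q))
            *\<^sub>R cell_grad K v (cnode D K q), 0)"
    unfolding sum_momentum_only[symmetric]
    by (rule sum.cong) (use \<gamma> node_U in \<open>simp_all add: flux_equilibrium\<close>)
  have edge: "(\<Sum>\<mu>=1..nedge D. (ewt D \<mu> * int_val K v (enode D e \<mu>))
          *\<^sub>R num_flux \<gamma> D bp ph bU U K e (enode D e \<mu>)) =
      (0, \<Sum>\<mu>=1..nedge D. (ewt D \<mu> * p_star D bp ph K e (enode D e \<mu>)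
            * int_val K v (enode D e \<mu>)) *\<^sub>R outward_normal K e, 0)"
    if "e \<in> cell_edges D K" for e
    unfolding sum_momentum_only[symmetric]
    by (rule sum.cong[OF refl]) (simp add: edge_flux[OF that] mult_ac)
  have edges: "(\<Sum>e\<in>cell_edges D K. diameter e *\<^sub>R
          (\<Sum>\<mu>=1..nedge D. (ewt D \<mu> * int_val K v (enode D e \<mu>))
             *\<^sub>R num_flux \<gamma> D bp ph bU U K e (enode D e \<mu>))) =
      (0, \<Sum>e\<in>cell_edges D K. diameter e *\<^sub>R
        (\<Sum>\<mu>=1..nedge D. (ewt D \<mu> * p_star D bp ph K e (enode D e \<mu>)
            * int_val K v (enode D e \<mu>)) *\<^sub>R outward_normal K e), 0)"
    unfolding sum_momentum_only[symmetric]
    by (rule sum.cong[OF refl]) (simp only: edge scaleR_Pair scaleR_zero_right)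
  show "dg_rhs \<gamma> D \<rho>h bp ph bU U K v = 0"
    unfolding dg_rhs_def S2 S3 vol edges b_vec_def
    by (simp add: zero_prod_def)
qed

end
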